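(* Let $\mathcal{H}$ be a real Hilbert space, let $D$ be a nonempty closed convex subset of $\mathcal{H}$, let $m\geq 2$ be an integer, let $I=\{1,\ldots,m\}$, and let $(T_i)_{i\in I}$ be a family of nonexpansive operators from $D$ to $D$. Set $T=\frac1m\sum_{i\in I}T_i$ and, for every $\varepsilon\in\,]0,1[$, $$R^{\varepsilon}=\big(\operatorname{Id}+\varepsilon(T_m-\operatorname{Id})\big)\circ\cdots\circ\big(\operatorname{Id}+\varepsilon(T_1-\operatorname{Id})\big).$$ Suppose that there exist $\eta\in\,]0,1]$ and $\beta\in\,]0,+\infty[$ such that for every $\varepsilon\in\,]0,\eta[$ there exists $z^{\varepsilon}\in\operatorname{Fix}R^{\varepsilon}$ with $\|z^{\varepsilon}\|\leq\beta$. Then $\operatorname{Fix}T\neq\varnothing$. Now let $(z^{\varepsilon})_{\varepsilon\in]0,\eta[}$ be such a bounded curve (that is, $z^{\varepsilon}\in\operatorname{Fix}R^{\varepsilon}$ and $\|z^{\varepsilon}\|\leq\beta$ for every $\varepsilon\in\,]0,\eta[$) and, for every $\varepsilon\in\,]0,\eta[$, set $x_0^{\varepsilon}=z^{\varepsilon}$ and $x_i^{\varepsilon}=x_{i-1}^{\varepsilon}+\varepsilon(T_ix_{i-1}^{\varepsilon}-x_{i-1}^{\varepsilon})$ for $i=1,\ldots,m$, so that $x_m^{\varepsilon}=z^{\varepsilon}=x_0^{\varepsilon}$. Then the family $(x_1^{\varepsilon},\ldots,x_m^{\varepsilon})_{\varepsilon\in]0,\eta[}$ is bounded, and each of its weak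 sequential cluster points (as $\varepsilon\to0$) is of the form $(x,\ldots,x)$, where $x\in\operatorname{Fix}T$. Moreover, $$(\forall i\in I)\quad \lim_{\varepsilon\to0}\|x_i^{\varepsilon}-x_{i-1}^{\varepsilon}\|=0.$$ In addition, suppose that one of the following holds: (i) for all $x,y\in\operatorname{Fix}T$, $\langle x_m^{\varepsilon}\mid x-y\rangle$ converges as $\varepsilon\to0$; (ii) for all $x\in\operatorname{Fix}T$, $\|x_m^{\varepsilon}-x\|$ converges as $\varepsilon\to0$; (iii) $\operatorname{Fix}T$ is a singleton. Then there exists $\overline{x}\in\operatorname{Fix}T$ such that, for every $i\in I$, $x_i^{\varepsilon}\rightharpoonup\overline{x}$ as $\varepsilon\to0$. Finally, suppose in addition that $\operatorname{Id}-T$ is demiregular on $\operatorname{Fix}T$, i.e., for every sequence $(y_k)_{k\in\mathbb{N}}$ in $D$ and every $y\in\operatorname{Fix}T$, $$\big(y_k\rightharpoonup y\ \text{ and }\ y_k-Ty_k\to0\big)\ \Rightarrow\ y_k\to y.$$ Then, for every $i\in I$, $x_i^{\varepsilon}\to\overline{x}$ as $\varepsilon\to0$.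
   Context: Nonexpansive means $1$-Lipschitz for the norm of $\mathcal{H}$. $\operatorname{Id}$ is the identity operator, $\operatorname{Fix}$ denotes the set of fixed points, and $\langle\cdot\mid\cdot\rangle$ is the scalar product of $\mathcal{H}$. The symbols $\rightharpoonup$ and $\to$ denote weak and strong convergence, respectively. A weak sequential cluster point of a family indexed by $\varepsilon\in\,]0,\eta[$, as $\varepsilon\to 0$, is a weak limit of the family along some sequence $(\varepsilon_n)_{n\in\mathbb{N}}$ in $]0,\eta[$ with $\varepsilon_n\to0$. *)

theory Defs
  imports "HOL-Analysis.Analysis"
begin

definition Fix_on :: "'a set \<Rightarrow> ('a \<Rightarrow> 'a) \<Rightarrow> 'a set" where
  "Fix_on D f = {x \<in> D. f x = x}"

definition nonexpansive_on :: "'a::real_normed_vector set \<Rightarrow> ('a \<Rightarrow> 'a) \<Rightarrow> bool" where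
  "nonexpansive_on D f \<longleftrightarrow> 1-lipschitz_on D f"

text \<open>Weak convergence in a Hilbert space: every continuous linear functional is of the form
  \<open>x \<mapsto> x \<bullet> u\<close>.\<close>

definition weakly_tendsto :: "('b \<Rightarrow> 'a::real_inner) \<Rightarrow> 'a \<Rightarrow> 'b filter \<Rightarrow> bool" where
  "weakly_tendsto f l F \<longleftrightarrow> (\<forall>u. ((\<lambda>t. f t \<bullet> u) \<longlongrightarrow> l \<bullet> u) F)"

text \<open>An \<open>m\<close>-tuple \<open>(w\<^sub>1, \<dots>, w\<^sub>m)\<close> is a function \<open>w\<close> on \<open>nat\<close> of which only the values at
  \<open>1, \<dots>, m\<close> matter. The space of \<open>m\<close>-tuples is the Hilbert direct sum, with norm
  \<open>L2_set (\<lambda>i. norm (w i)) {1..m}\<close> and the scalar product used below.\<close>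

definition tuple_bounded_on :: "nat \<Rightarrow> 'b set \<Rightarrow> (nat \<Rightarrow> 'b \<Rightarrow> 'a::real_inner) \<Rightarrow> bool" where
  "tuple_bounded_on m S x \<longleftrightarrow> (\<exists>B. \<forall>t\<in>S. L2_set (\<lambda>i. norm (x i t)) {1..m} \<le> B)"

definition tuple_weakly_tendsto ::
    "nat \<Rightarrow> (nat \<Rightarrow> 'b \<Rightarrow> 'a::real_inner) \<Rightarrow> (nat \<Rightarrow> 'a) \<Rightarrow> 'b filter \<Rightarrow> bool" where
  "tuple_weakly_tendsto m x w F \<longleftrightarrow>
     (\<forall>u :: nat \<Rightarrow> 'a. ((\<lambda>t. \<Sum>i\<in>{1..m}. x i t \<bullet> u i) \<longlongrightarrow> (\<Sum>i\<in>{1..m}. w i \<bullet> u i)) F)"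

definition tuple_weak_seq_cluster_point ::
    "nat \<Rightarrow> real \<Rightarrow> (nat \<Rightarrow> real \<Rightarrow> 'a::real_inner) \<Rightarrow> (nat \<Rightarrow> 'a) \<Rightarrow> bool" where
  "tuple_weak_seq_cluster_point m \<eta> x w \<longleftrightarrow>
     (\<exists>e :: nat \<Rightarrow> real. (\<forall>n. e n \<in> {0<..<\<eta>}) \<and> e \<longlonglongrightarrow> 0 \<and>
        tuple_weakly_tendsto m (\<lambda>i n. x i (e n)) w sequentially)"

definition avg_op :: "nat \<Rightarrow> (nat \<Rightarrow> 'a::real_vector \<Rightarrow> 'a) \<Rightarrow> 'a \<Rightarrow> 'a" where
  "avg_op m T x = (1 / real m) *\<^sub>R (\<Sum>i\<in>{1..m}. T i x)"

definition relaxed :: "real \<Rightarrow> ('a::real_vector \<Rightarrow> 'a) \<Rightarrow> 'a \<Rightarrow> 'a" where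
  "relaxed \<epsilon> f x = x + \<epsilon> *\<^sub>R (f x - x)"

text \<open>\<open>relaxed_comp T \<epsilon> m = relaxed \<epsilon> (T m) \<circ> \<dots> \<circ> relaxed \<epsilon> (T 1)\<close>\<close>

primrec relaxed_comp :: "(nat \<Rightarrow> 'a::real_vector \<Rightarrow> 'a) \<Rightarrow> real \<Rightarrow> nat \<Rightarrow> 'a \<Rightarrow> 'a" where
  "relaxed_comp T \<epsilon> 0 = id"
| "relaxed_comp T \<epsilon> (Suc k) = relaxed \<epsilon> (T (Suc k)) \<circ> relaxed_comp T \<epsilon> k"

text \<open>Demiregularity of \<open>Id - f : D \<rightarrow> 'a\<close> on its set of zeros \<open>Fix_on D f\<close>.\<close>

definition Id_minus_demiregular_on_Fix :: "'a::real_inner set \<Rightarrow> ('a \<Rightarrow> 'a) \<Rightarrow> bool" where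
  "Id_minus_demiregular_on_Fix D f \<longleftrightarrow>
     (\<forall>(y :: nat \<Rightarrow> 'a) l. (\<forall>k. y k \<in> D) \<longrightarrow> l \<in> Fix_on D f \<longrightarrow>
        weakly_tendsto y l sequentially \<longrightarrow> (\<lambda>k. y k - f (y k)) \<longlonglongrightarrow> 0 \<longrightarrow> y \<longlonglongrightarrow> l)"

end

theory Submission
  imports Defs "HOL-Complex_Analysis.Great_Picard"
begin

text \<open>Why the theorem holds. Going once around the cycle brings \<open>x\<^sub>0\<close> back to itself, so its
  steps \<open>\<epsilon> (T\<^sub>i x\<^sub>i\<^sub>-\<^sub>1 - x\<^sub>i\<^sub>-\<^sub>1)\<close> add up to \<open>0\<close>. Dividing by \<open>\<epsilon>\<close> loses nothing: the displacements
  \<open>T\<^sub>i x\<^sub>i\<^sub>-\<^sub>1 - x\<^sub>i\<^sub>-\<^sub>1\<close> themselves add up to \<open>0\<close> (\<open>sum_displacement_eq_0\<close>). On a bounded curve each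
  step has size \<open>O(\<epsilon>)\<close>, so as \<open>\<epsilon> \<rightarrow> 0\<close> all points of the cycle merge with \<open>z \<epsilon>\<close>, and nonexpansiveness
  lets every displacement be evaluated at \<open>z \<epsilon>\<close> at the price of a vanishing error. Hence
  \<open>z \<epsilon> - T (z \<epsilon>) \<rightarrow> 0\<close> for the average \<open>T\<close> (\<open>residual_tendsto_0\<close>): the curve consists of approximate
  fixed points of one fixed nonexpansive operator.

  Everything else is a statement about bounded approximate fixed points. Demiclosedness
  (\<open>demiclosed_nonexpansive\<close>) puts their weak cluster points into \<open>Fix T\<close>, and weak sequential
  compactness (\<open>bounded_imp_weakly_convergent_subsequence\<close>) provides such points. Each of the three
  alternative conditions makes \<open>z \<epsilon> \<bullet> (p - q)\<close> converge for all \<open>p, q\<close> in \<open>Fix T\<close>, which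
  leaves room for only one cluster point; the curve then converges weakly to it
  (\<open>weak_convergence\<close>). Demiregularity turns weak into strong convergence because the residual is
  already known to vanish.

  Weak compactness combines a diagonal argument with convexity and represents no functionals: the
  parallelogram law gives nested closed bounded convex sets a common point
  (\<open>nested_closed_convex_Inter_nonempty\<close>), and this one fact yields both the projections and the
  weak limits.\<close>

section \<open>Projections and weak sequential compactness in Hilbert spaces\<close>

text \<open>Elements of almost minimal norm in \<open>C n\<close> form a Cauchy sequence, because by convexity the
  midpoint of two of them cannot have a much smaller norm, and the parallelogram law then forces
  them to be close. Their limit lies in every \<open>C n\<close>.\<close>

lemma nested_closed_convex_Inter_nonempty:
  fixes C :: "nat \<Rightarrow> 'a::{real_inner, complete_space} set"
  assumes closed: "\<And>n. closed (C n)" and convex: "\<And>n. convex (C n)"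
    and nonempty: "\<And>n. C n \<noteq> {}" and dec: "decseq C" and bdd: "bounded (C 0)"
  shows "(\<Inter>n. C n) \<noteq> {}"
proof -
  define d where "d n = infdist 0 (C n)" for n
  have d_le: "d n \<le> norm y" if "y \<in> C n" for n y
    using infdist_le[OF that, of 0] by (simp add: d_def)
  have d_nonneg: "0 \<le> d n" for n
    by (simp add: d_def infdist_nonneg)
  have "incseq d"
    unfolding d_def incseq_def
    using dec nonempty by (auto simp: decseq_def intro!: infdist_mono)
  moreover obtain B where B: "\<And>y. y \<in> C 0 \<Longrightarrow> norm y \<le> B"
    using bdd by (auto simp: bounded_iff)
  have "d n \<le> B" for n
  proof -
    obtain y where "y \<in> C n" using nonempty by blast
    moreover from this have "y \<in> C 0" using dec by (auto simp: decseq_def)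
    ultimately show ?thesis using d_le B by (meson order_trans)
  qed
  ultimately obtain L where L: "d \<longlonglongrightarrow> L" "\<And>n. d n \<le> L"
    using incseq_convergent[of d B] by metis
  have "\<exists>y\<in>C n. norm y < d n + 1 / real (Suc n)" for n
  proof (rule ccontr)
    assume "\<not> ?thesis"
    then have "d n + 1 / real (Suc n) \<le> (INF y\<in>C n. dist 0 y)"
      using nonempty[of n] by (intro cINF_greatest) (auto simp: not_less)
    also have "\<dots> = d n" using nonempty[of n] by (simp add: d_def infdist_def)
    finally show False by simp
  qed
  then obtain y where y: "\<And>n. y n \<in> C n" "\<And>n. norm (y n) < d n + 1 / real (Suc n)"
    by metis
  define g where "g n = 4 * ((L + 1 / real (Suc n))\<^sup>2 - (d n)\<^sup>2)" for n
  have "g \<longlonglongrightarrow> 4 * ((L + 0)\<^sup>2 - L\<^sup>2)"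
    unfolding g_def by (intro tendsto_intros L LIMSEQ_Suc[OF lim_1_over_n])
  then have g: "g \<longlonglongrightarrow> 0" by simp
  \<comment> \<open>The midpoint of \<open>y n\<close> and \<open>y k\<close> lies in \<open>C n\<close>, so its norm is at least \<open>d n\<close>.\<close>
  have close: "(norm (y n - y k))\<^sup>2 \<le> g n" if "n \<le> k" for n k
  proof -
    have "y k \<in> C n" using that dec y(1)[of k] by (auto simp: decseq_def)
    then have "(1/2) *\<^sub>R y n + (1/2) *\<^sub>R y k \<in> C n"
      using y(1)[of n] convex[of n] by (intro convexD) auto
    then have "d n \<le> norm ((1/2) *\<^sub>R (y n + y k))"
      using d_le by (simp add: scaleR_add_right)
    then have "2 * d n \<le> norm (y n + y k)" by simp
    then have mid: "4 * (d n)\<^sup>2 \<le> (norm (y n + y k))\<^sup>2"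
      using power_mono[of "2 * d n" "norm (y n + y k)" 2] d_nonneg[of n]
      by (simp add: power_mult_distrib)
    have "norm (y k) \<le> L + 1 / real (Suc n)"
    proof -
      have "1 / real (Suc k) \<le> 1 / real (Suc n)" using that by (simp add: frac_le)
      then show ?thesis using y(2)[of k] L(2)[of k] by linarith
    qed
    then have "(norm (y k))\<^sup>2 \<le> (L + 1 / real (Suc n))\<^sup>2" by (intro power_mono) auto
    moreover have "norm (y n) \<le> L + 1 / real (Suc n)"
      using y(2)[of n] L(2)[of n] by linarith
    then have "(norm (y n))\<^sup>2 \<le> (L + 1 / real (Suc n))\<^sup>2" by (intro power_mono) auto
    moreover have "(norm (y n - y k))\<^sup>2 + (norm (y n + y k))\<^sup>2
        = 2 * (norm (y n))\<^sup>2 + 2 * (norm (y k))\<^sup>2"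
      by (simp add: power2_norm_eq_inner algebra_simps inner_commute)
    ultimately show ?thesis using mid by (simp add: g_def)
  qed
  have "Cauchy y"
  proof (rule metric_CauchyI)
    fix e :: real assume e: "e > 0"
    then have "\<forall>\<^sub>F n in sequentially. g n < (e/2)\<^sup>2"
      using order_tendstoD(2)[OF g, of "(e/2)\<^sup>2"] by simp
    then obtain N where "g N < (e/2)\<^sup>2" by (auto simp: eventually_sequentially)
    then have "norm (y N - y k) < e/2" if "N \<le> k" for k
      using close[OF that] e by (intro power2_less_imp_less[of _ "e/2"]) auto
    then have near: "dist (y N) (y k) < e/2" if "N \<le> k" for k
      using that unfolding dist_norm .
    show "\<exists>M. \<forall>i\<ge>M. \<forall>j\<ge>M. dist (y i) (y j) < e"
      using near by (meson dist_triangle_half_r)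
  qed
  then obtain w where w: "y \<longlonglongrightarrow> w" using Cauchy_convergent convergent_def by blast
  have "w \<in> C n" for n
  proof (rule Lim_in_closed_set[OF closed _ _ w])
    have "y k \<in> C n" if "n \<le> k" for k
      using y(1)[of k] decseqD[OF dec that] by auto
    then show "\<forall>\<^sub>F k in sequentially. y k \<in> C n"
      by (rule eventually_sequentiallyI)
  qed simp
  then show ?thesis by auto
qed

text \<open>A nearest point lies in the intersection of the sets \<open>C \<inter> cball a (r + 1/(n+1))\<close>, where
  \<open>r\<close> is the distance from \<open>a\<close> to \<open>C\<close>; so no compactness of balls is needed.\<close>

lemma projection_closed_convex:
  fixes C :: "'a::{real_inner, complete_space} set"
  assumes "closed C" "convex C" "C \<noteq> {}"
  obtains p where "p \<in> C" "\<And>u. u \<in> C \<Longrightarrow> (a - p) \<bullet> (u - p) \<le> 0"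
proof -
  define K where "K n = C \<inter> cball a (infdist a C + 1 / real (Suc n))" for n
  have "(\<Inter>n. K n) \<noteq> {}"
  proof (rule nested_closed_convex_Inter_nonempty)
    show "closed (K n)" "convex (K n)" for n
      using assms by (auto simp: K_def intro: convex_Int)
    show "decseq K"
    proof (unfold decseq_def, intro allI impI)
      fix n k :: nat assume "n \<le> k"
      then have "1 / real (Suc k) \<le> 1 / real (Suc n)" by (simp add: frac_le)
      then show "K k \<subseteq> K n" by (auto simp: K_def)
    qed
    show "bounded (K 0)" by (simp add: K_def bounded_Int)
    show "K n \<noteq> {}" for n
    proof (rule ccontr)
      assume "\<not> K n \<noteq> {}"
      then have "infdist a C + 1 / real (Suc n) \<le> dist a u" if "u \<in> C" for u
        using that unfolding K_def by fastforce
      then have "infdist a C + 1 / real (Suc n) \<le> (INF u\<in>C. dist a u)"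
        using assms(3) by (intro cINF_greatest)
      then have "infdist a C + 1 / real (Suc n) \<le> infdist a C"
        using assms(3) by (simp add: infdist_def)
      then show False by simp
    qed
  qed
  then obtain p where p: "\<And>n. p \<in> K n" by blast
  have "dist a p \<le> infdist a C"
  proof (rule LIMSEQ_le_const)
    show "(\<lambda>n. infdist a C + 1 / real (Suc n)) \<longlonglongrightarrow> infdist a C"
      using tendsto_add[OF tendsto_const LIMSEQ_Suc[OF lim_1_over_n]] by fastforce
    show "\<exists>N. \<forall>n\<ge>N. dist a p \<le> infdist a C + 1 / real (Suc n)"
      using p by (auto simp: K_def)
  qed
  then have "\<forall>u\<in>C. dist a p \<le> dist a u" using infdist_le order_trans by blast
  moreover have "p \<in> C" using p[of 0] by (simp add: K_def)
  ultimately show ?thesis using that any_closest_point_dot[OF assms(2,1)] by blast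
qed

lemma projection_closed_subspace:
  fixes V :: "'a::{real_inner, complete_space} set"
  assumes "closed V" "subspace V"
  obtains p where "p \<in> V" "\<And>u. u \<in> V \<Longrightarrow> (a - p) \<bullet> u = 0"
proof -
  have "V \<noteq> {}" using subspace_0[OF assms(2)] by blast
  then obtain p where p: "p \<in> V" "\<And>u. u \<in> V \<Longrightarrow> (a - p) \<bullet> (u - p) \<le> 0"
    using projection_closed_convex[OF assms(1) subspace_imp_convex[OF assms(2)]] by metis
  have "(a - p) \<bullet> u = 0" if "u \<in> V" for u
  proof -
    have "p + u \<in> V" "p - u \<in> V"
      using that p(1) assms(2) by (auto intro: subspace_add subspace_diff)
    from this[THEN p(2)] show ?thesis by simp
  qed
  with p(1) show ?thesis using that by blast
qed

text \<open>Weak limits are not norm limits, but the half space that separates a point from its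
  projection onto \<open>C\<close> is weakly closed.\<close>

lemma weak_limit_in_closed_convex:
  fixes C :: "'a::{real_inner, complete_space} set"
  assumes "closed C" "convex C" and y: "\<And>n. y n \<in> C"
    and weak: "weakly_tendsto y w sequentially"
  shows "w \<in> C"
proof -
  obtain p where p: "p \<in> C" "\<And>u. u \<in> C \<Longrightarrow> (w - p) \<bullet> (u - p) \<le> 0"
    using projection_closed_convex[OF assms(1,2)] y[of 0] by blast
  have "(\<lambda>n. y n \<bullet> (w - p) - p \<bullet> (w - p)) \<longlonglongrightarrow> w \<bullet> (w - p) - p \<bullet> (w - p)"
    using weak by (intro tendsto_diff tendsto_const) (simp add: weakly_tendsto_def)
  moreover have "y n \<bullet> (w - p) - p \<bullet> (w - p) \<le> 0" for n
    using p(2)[OF y[of n]] by (simp add: inner_commute inner_diff_right)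
  ultimately have "w \<bullet> (w - p) - p \<bullet> (w - p) \<le> 0"
    by (intro LIMSEQ_le_const2) auto
  then have "(w - p) \<bullet> (w - p) \<le> 0" by (simp add: inner_diff_left)
  then have "w = p" by (metis inner_ge_zero inner_eq_zero_iff order_antisym right_minus_eq)
  with p(1) show ?thesis by simp
qed

lemma weakly_tendstoD:
  "weakly_tendsto f l F \<Longrightarrow> ((\<lambda>t. f t \<bullet> u) \<longlongrightarrow> l \<bullet> u) F"
  by (simp add: weakly_tendsto_def)

lemma weakly_tendsto_unique:
  assumes "weakly_tendsto f p F" "weakly_tendsto f q F" "F \<noteq> bot"
  shows "p = q"
proof -
  have "p \<bullet> (p - q) = q \<bullet> (p - q)"
    by (rule tendsto_unique[OF assms(3) weakly_tendstoD[OF assms(1)] weakly_tendstoD[OF assms(2)]])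
  then have "(p - q) \<bullet> (p - q) = 0" by (simp add: inner_diff_left)
  then show ?thesis by simp
qed

lemma weakly_tendsto_add_strong:
  assumes "weakly_tendsto f p F" "((\<lambda>t. g t - f t) \<longlongrightarrow> 0) F"
  shows "weakly_tendsto g p F"
  unfolding weakly_tendsto_def
proof
  fix u
  have "((\<lambda>t. (g t - f t) \<bullet> u + f t \<bullet> u) \<longlongrightarrow> 0 \<bullet> u + p \<bullet> u) F"
    using assms(1) tendsto_inner[OF assms(2) tendsto_const]
    by (intro tendsto_add) (auto simp: weakly_tendsto_def)
  then show "((\<lambda>t. g t \<bullet> u) \<longlongrightarrow> p \<bullet> u) F" by (simp add: inner_diff_left)
qed

text \<open>A diagonal subsequence \<open>s\<close> makes the scalar products with all members of \<open>y\<close> converge. A point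
  \<open>w\<close> common to the closed convex hulls of the tails of \<open>s\<close> must have \<open>w \<bullet> v\<close> as the limit
  of \<open>s n \<bullet> v\<close> whenever that limit exists; it takes the place of a Riesz representative of
  the limit functional. The vectors \<open>v\<close> for which the limit exists form a closed subspace that
  contains the whole sequence. It also contains its own orthogonal complement, on which the
  limit is \<open>0\<close>, and so exhausts the space.\<close>

theorem bounded_imp_weakly_convergent_subsequence:
  fixes y :: "nat \<Rightarrow> 'a::{real_inner, complete_space}"
  assumes "bounded (range y)"
  obtains r w where "strict_mono r" "weakly_tendsto (y \<circ> r) w sequentially"
proof -
  obtain B where B: "B > 0" "\<And>n. norm (y n) \<le> B"
    using assms by (auto simp: bounded_pos)
  have "norm (y n \<bullet> v) \<le> B * B" if "v \<in> range y" for n v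
  proof -
    have "\<bar>y n \<bullet> v\<bar> \<le> norm (y n) * norm v" by (rule Cauchy_Schwarz_ineq2)
    also have "\<dots> \<le> B * B" using that B by (intro mult_mono) auto
    finally show ?thesis by simp
  qed
  then obtain r where r: "strict_mono r" "\<And>v. v \<in> range y \<Longrightarrow> \<exists>l. (\<lambda>n. y (r n) \<bullet> v) \<longlonglongrightarrow> l"
    using function_convergent_subsequence[of "range y" "\<lambda>n v. y n \<bullet> v" "B * B"]
    by (metis countable_image countableI_type)
  define s where "s = y \<circ> r"
  have s_range: "s n \<in> range y" for n by (simp add: s_def)
  define C where "C n = closure (convex hull (s ` {n..}))" for n
  have "(\<Inter>n. C n) \<noteq> {}"
  proof (rule nested_closed_convex_Inter_nonempty)
    show "closed (C n)" "convex (C n)" "C n \<noteq> {}" for n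
      by (auto simp: C_def convex_closure)
    show "decseq C"
      unfolding decseq_def C_def by (intro allI impI closure_mono hull_mono image_mono) auto
    have "s ` {0..} \<subseteq> range y" using s_range by auto
    then show "bounded (C 0)"
      unfolding C_def using assms by (intro bounded_closure bounded_convex_hull) (rule bounded_subset)
  qed
  then obtain w where w: "\<And>n. w \<in> C n" by blast
  have limit: "w \<bullet> v = l" if l: "(\<lambda>n. s n \<bullet> v) \<longlonglongrightarrow> l" for v l
  proof -
    have "\<bar>w \<bullet> v - l\<bar> \<le> e" if e: "e > 0" for e
    proof -
      obtain N where N: "\<And>n. n \<ge> N \<Longrightarrow> \<bar>s n \<bullet> v - l\<bar> < e"
        using LIMSEQ_D[OF l e] by auto
      \<comment> \<open>The tail lies in a slab, which is closed and convex.\<close>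
      let ?S = "{x. v \<bullet> x \<le> l + e} \<inter> {x. v \<bullet> x \<ge> l - e}"
      have "s ` {N..} \<subseteq> ?S"
      proof
        fix x assume "x \<in> s ` {N..}"
        then obtain n where "n \<ge> N" "x = s n" by auto
        with N[of n] show "x \<in> ?S" by (auto simp: inner_commute abs_less_iff)
      qed
      moreover have "convex ?S"
        by (intro convex_Int convex_halfspace_le convex_halfspace_ge)
      moreover have "closed ?S"
        by (intro closed_Int closed_halfspace_le closed_halfspace_ge)
      ultimately have "C N \<subseteq> ?S"
        unfolding C_def by (intro closure_minimal hull_minimal)
      with w[of N] show ?thesis by (auto simp: inner_commute abs_le_iff)
    qed
    then have "\<bar>w \<bullet> v - l\<bar> \<le> 0" by (rule field_le_epsilon[of _ "0::real", unfolded add_0])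
    then show ?thesis by simp
  qed
  define V where "V = {v. (\<lambda>n. s n \<bullet> v) \<longlonglongrightarrow> w \<bullet> v}"
  have V_range: "v \<in> V" if v: "v \<in> range y" for v
  proof -
    obtain l where "(\<lambda>n. y (r n) \<bullet> v) \<longlonglongrightarrow> l" using r(2)[OF v] ..
    then have l: "(\<lambda>n. s n \<bullet> v) \<longlonglongrightarrow> l" by (simp add: s_def)
    with limit[OF l] show ?thesis by (simp add: V_def)
  qed
  have sub: "subspace V"
  proof (rule subspaceI)
    show "0 \<in> V" by (simp add: V_def)
    show "a + b \<in> V" if "a \<in> V" "b \<in> V" for a b
      using that unfolding V_def inner_add_right mem_Collect_eq by (rule tendsto_add)
    show "c *\<^sub>R a \<in> V" if "a \<in> V" for a c
      using that unfolding V_def inner_scaleR_right mem_Collect_eq by (rule tendsto_mult_left)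
  qed
  have "closed V"
    unfolding closed_limpt islimpt_approachable
  proof (intro allI impI)
    fix v assume v: "\<forall>e>0. \<exists>v'\<in>V. v' \<noteq> v \<and> dist v' v < e"
    show "v \<in> V"
      unfolding V_def
    proof (rule CollectI, rule LIMSEQ_I)
      fix e :: real assume e: "e > 0"
      define c where "c = B + norm w"
      have c: "c > 0" using B(1) by (simp add: c_def add_pos_nonneg)
      obtain v' where v': "v' \<in> V" "dist v' v < e / (2 * c)"
        using v e c by (meson divide_pos_pos mult_pos_pos zero_less_numeral)
      obtain N where N: "\<And>n. n \<ge> N \<Longrightarrow> norm (s n \<bullet> v' - w \<bullet> v') < e / 2"
        using LIMSEQ_D[of "\<lambda>n. s n \<bullet> v'" "w \<bullet> v'" "e/2"] v'(1) e unfolding V_def by auto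
      have "norm (s n \<bullet> v - w \<bullet> v) < e" if "n \<ge> N" for n
      proof -
        have "norm (s n - w) \<le> c"
          using norm_triangle_ineq4[of "s n" w] B(2)[of "r n"] by (simp add: c_def s_def)
        then have "norm (s n - w) * norm (v - v') \<le> c * (e / (2 * c))"
          using v'(2) c e by (intro mult_mono) (auto simp: dist_norm norm_minus_commute)
        then have "\<bar>(s n - w) \<bullet> (v - v')\<bar> \<le> e / 2"
          using Cauchy_Schwarz_ineq2[of "s n - w" "v - v'"] c by simp
        moreover have "s n \<bullet> v - w \<bullet> v = (s n - w) \<bullet> (v - v') + (s n \<bullet> v' - w \<bullet> v')"
          by (simp add: inner_diff_left inner_diff_right)
        ultimately show ?thesis using N[OF that] unfolding real_norm_def by linarith
      qed
      then show "\<exists>N. \<forall>n\<ge>N. norm (s n \<bullet> v - w \<bullet> v) < e" by blast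
    qed
  qed
  have "v \<in> V" for v
  proof -
    obtain p where p: "p \<in> V" "\<And>u. u \<in> V \<Longrightarrow> (v - p) \<bullet> u = 0"
      using projection_closed_subspace[OF \<open>closed V\<close> sub] by metis
    \<comment> \<open>Since \<open>v - p\<close> is orthogonal to the sequence, its scalar products with it converge to
      \<open>0\<close>; so \<open>v - p\<close> also belongs to \<open>V\<close>.\<close>
    have "s n \<bullet> (v - p) = 0" for n
      using p(2)[OF V_range[OF s_range[of n]]] by (simp add: inner_commute)
    then have "(\<lambda>n. s n \<bullet> (v - p)) \<longlonglongrightarrow> 0" by simp
    then have "v - p \<in> V" using limit[of "v - p" 0] by (simp add: V_def)
    then have "(v - p) + p \<in> V" using p(1) by (rule subspace_add[OF sub])
    then show ?thesis by simp
  qed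
  then have "weakly_tendsto (y \<circ> r) w sequentially"
    by (auto simp: weakly_tendsto_def V_def s_def)
  with r(1) show ?thesis using that by blast
qed

section \<open>Nonexpansive operators\<close>

text \<open>Demiclosedness. Nonexpansiveness makes \<open>f w\<close> asymptotically no farther from \<open>y n\<close> than \<open>w\<close> is.
  Expanding \<open>(norm (y n - f w))\<^sup>2\<close> about the weak limit \<open>w\<close> turns this into
  \<open>(norm (w - f w))\<^sup>2 \<le> 0\<close>, since the cross term vanishes in the limit.\<close>

lemma demiclosed_nonexpansive:
  fixes D :: "'a::{real_inner, complete_space} set"
  assumes D: "closed D" "convex D" and f: "nonexpansive_on D f"
    and y: "\<And>n. y n \<in> D" and bdd: "bounded (range y)"
    and weak: "weakly_tendsto y w sequentially"
    and res: "(\<lambda>n. y n - f (y n)) \<longlonglongrightarrow> 0"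
  shows "w \<in> Fix_on D f"
proof -
  have w: "w \<in> D" using weak_limit_in_closed_convex[OF D y weak] .
  obtain B where B: "\<And>n. norm (y n) \<le> B" using bdd by (auto simp: bounded_iff)
  define a where "a n = norm (y n - f (y n))" for n
  define b where "b = B + norm w"
  have bound: "(norm (w - f w))\<^sup>2
      \<le> (a n)\<^sup>2 + 2 * a n * b - 2 * (y n \<bullet> (w - f w) - w \<bullet> (w - f w))" for n
  proof -
    have "norm (f (y n) - f w) \<le> norm (y n - w)"
      using lipschitz_on_normD[OF f[unfolded nonexpansive_on_def] y w] by simp
    moreover have "norm (y n - f w) \<le> a n + norm (f (y n) - f w)"
      using norm_triangle_ineq[of "y n - f (y n)" "f (y n) - f w"] by (simp add: a_def)
    ultimately have "norm (y n - f w) \<le> a n + norm (y n - w)" by linarith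
    then have "(norm (y n - f w))\<^sup>2 \<le> (a n + norm (y n - w))\<^sup>2" by (intro power_mono) auto
    also have "\<dots> = (a n)\<^sup>2 + 2 * a n * norm (y n - w) + (norm (y n - w))\<^sup>2"
      by (simp add: power2_sum)
    also have "2 * a n * norm (y n - w) \<le> 2 * a n * b"
      using norm_triangle_ineq4[of "y n" w] B[of n]
      by (intro mult_left_mono) (auto simp: b_def a_def)
    finally have "(norm (y n - f w))\<^sup>2 \<le> (a n)\<^sup>2 + 2 * a n * b + (norm (y n - w))\<^sup>2" by simp
    moreover have "(norm (y n - f w))\<^sup>2
        = (norm (y n - w))\<^sup>2 + 2 * (y n \<bullet> (w - f w) - w \<bullet> (w - f w)) + (norm (w - f w))\<^sup>2"
      by (simp add: power2_norm_eq_inner algebra_simps inner_commute)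
    ultimately show ?thesis by linarith
  qed
  have "a \<longlonglongrightarrow> 0" unfolding a_def using res by (rule tendsto_norm_zero)
  then have "(\<lambda>n. (a n)\<^sup>2 + 2 * a n * b - 2 * (y n \<bullet> (w - f w) - w \<bullet> (w - f w)))
      \<longlonglongrightarrow> 0\<^sup>2 + 2 * 0 * b - 2 * (w \<bullet> (w - f w) - w \<bullet> (w - f w))"
    using weak
    by (intro tendsto_add tendsto_diff tendsto_mult tendsto_power tendsto_const)
      (auto simp: weakly_tendsto_def)
  then have "(norm (w - f w))\<^sup>2 \<le> 0\<^sup>2 + 2 * 0 * b - 2 * (w \<bullet> (w - f w) - w \<bullet> (w - f w))"
    by (rule LIMSEQ_le_const) (use bound in blast)
  then have "f w = w" by simp
  with w show ?thesis by (simp add: Fix_on_def)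
qed

lemma nonexpansive_on_avg_op:
  assumes "\<And>i. i \<in> {1..m} \<Longrightarrow> nonexpansive_on D (T i)"
  shows "nonexpansive_on D (avg_op m T)"
  unfolding nonexpansive_on_def
proof (rule lipschitz_onI)
  fix x y assume "x \<in> D" "y \<in> D"
  then have "norm (T i x - T i y) \<le> norm (x - y)" if "i \<in> {1..m}" for i
    using lipschitz_on_normD[OF assms[OF that, unfolded nonexpansive_on_def]] by simp
  then have "norm (\<Sum>i\<in>{1..m}. T i x - T i y) \<le> (\<Sum>i\<in>{1..m}. norm (x - y))"
    by (intro sum_norm_le)
  then have "norm (\<Sum>i\<in>{1..m}. T i x - T i y) / real m \<le> norm (x - y)"
    by (cases "m = 0") (simp_all add: divide_le_eq mult.commute)
  then show "dist (avg_op m T x) (avg_op m T y) \<le> 1 * dist x y"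
    by (simp add: avg_op_def dist_norm sum_subtractf flip: scaleR_diff_right)
qed simp

lemma bounded_nonexpansive_image:
  assumes "nonexpansive_on D f" "S \<subseteq> D" "bounded S"
  shows "bounded (f ` S)"
proof (cases "S = {}")
  case False
  then obtain a where a: "a \<in> S" by blast
  obtain B where B: "\<And>u. u \<in> S \<Longrightarrow> dist a u \<le> B"
    using assms(3) bounded_any_center[of S a] by auto
  have "dist (f a) (f u) \<le> B" if "u \<in> S" for u
  proof -
    have "dist (f a) (f u) \<le> 1 * dist a u"
      using assms(1,2) a that by (intro lipschitz_onD[of 1 D]) (auto simp: nonexpansive_on_def)
    with B[OF that] show ?thesis by simp
  qed
  then show ?thesis unfolding bounded_def by blast
qed simp

section \<open>Bounded curves of relaxed cycles\<close>

locale relaxed_cycle_curve =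
  fixes D :: "'a::{real_inner, complete_space} set"
    and m :: nat and T :: "nat \<Rightarrow> 'a \<Rightarrow> 'a"
    and \<eta> \<beta> :: real and z :: "real \<Rightarrow> 'a" and x :: "nat \<Rightarrow> real \<Rightarrow> 'a"
  assumes closed_D: "closed D" and convex_D: "convex D" and m_pos: "0 < m"
    and maps: "\<And>i. i \<in> {1..m} \<Longrightarrow> T i \<in> D \<rightarrow> D"
    and nonexp: "\<And>i. i \<in> {1..m} \<Longrightarrow> nonexpansive_on D (T i)"
    and \<eta>: "0 < \<eta>" "\<eta> \<le> 1"
    and z_Fix: "\<And>\<epsilon>. \<epsilon> \<in> {0<..<\<eta>} \<Longrightarrow> z \<epsilon> \<in> Fix_on D (relaxed_comp T \<epsilon> m)"
    and z_le: "\<And>\<epsilon>. \<epsilon> \<in> {0<..<\<eta>} \<Longrightarrow> norm (z \<epsilon>) \<le> \<beta>"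
    and x_0: "\<And>\<epsilon>. \<epsilon> \<in> {0<..<\<eta>} \<Longrightarrow> x 0 \<epsilon> = z \<epsilon>"
    and x_step: "\<And>\<epsilon> i. \<epsilon> \<in> {0<..<\<eta>} \<Longrightarrow> i \<in> {1..m} \<Longrightarrow>
      x i \<epsilon> = x (i - 1) \<epsilon> + \<epsilon> *\<^sub>R (T i (x (i - 1) \<epsilon>) - x (i - 1) \<epsilon>)"
begin

lemma eventually_\<eta>: "\<forall>\<^sub>F \<epsilon> in at_right 0. \<epsilon> \<in> {0<..<\<eta>}"
  using \<eta>(1) eventually_at_right_real by blast

lemma x_Suc:
  assumes "\<epsilon> \<in> {0<..<\<eta>}" "i < m"
  shows "x (Suc i) \<epsilon> = x i \<epsilon> + \<epsilon> *\<^sub>R (T (Suc i) (x i \<epsilon>) - x i \<epsilon>)"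
  using x_step[OF assms(1), of "Suc i"] assms(2) by simp

lemma x_Suc_convex:
  assumes "\<epsilon> \<in> {0<..<\<eta>}" "i < m"
  shows "x (Suc i) \<epsilon> = (1 - \<epsilon>) *\<^sub>R x i \<epsilon> + \<epsilon> *\<^sub>R T (Suc i) (x i \<epsilon>)"
  using x_Suc[OF assms] by (simp add: algebra_simps)

lemma x_in_D:
  assumes "\<epsilon> \<in> {0<..<\<eta>}" "i \<le> m"
  shows "x i \<epsilon> \<in> D"
  using assms(2)
proof (induction i)
  case 0
  then show ?case using x_0[OF assms(1)] z_Fix[OF assms(1)] by (simp add: Fix_on_def)
next
  case (Suc i)
  then have "x i \<epsilon> \<in> D" "T (Suc i) (x i \<epsilon>) \<in> D" using maps[of "Suc i"] by auto
  then show ?case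
    using x_Suc_convex[OF assms(1), of i] Suc.prems assms(1) \<eta> convex_D
    by (auto intro!: convexD)
qed

lemma z_in_D: "\<epsilon> \<in> {0<..<\<eta>} \<Longrightarrow> z \<epsilon> \<in> D"
  using z_Fix by (simp add: Fix_on_def)

lemma x_m:
  assumes "\<epsilon> \<in> {0<..<\<eta>}"
  shows "x m \<epsilon> = z \<epsilon>"
proof -
  have "x i \<epsilon> = relaxed_comp T \<epsilon> i (z \<epsilon>)" if "i \<le> m" for i
    using that by (induction i) (auto simp: x_0[OF assms] x_Suc[OF assms] relaxed_def)
  then show ?thesis using z_Fix[OF assms] by (simp add: Fix_on_def)
qed

lemma bounded_z: "bounded (z ` {0<..<\<eta>})"
  unfolding bounded_iff using z_le by blast

lemma bounded_x:
  assumes "i \<le> m"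
  shows "bounded (x i ` {0<..<\<eta>})"
  using assms
proof (induction i)
  case 0
  then show ?case using bounded_z x_0 unfolding bounded_iff by simp
next
  case (Suc i)
  then have bdd: "bounded (x i ` {0<..<\<eta>})" by simp
  then have "bounded (T (Suc i) ` x i ` {0<..<\<eta>})"
    using Suc.prems nonexp[of "Suc i"] x_in_D
    by (intro bounded_nonexpansive_image[of D]) auto
  then obtain B where B: "\<And>\<epsilon>. \<epsilon> \<in> {0<..<\<eta>} \<Longrightarrow> norm (T (Suc i) (x i \<epsilon>)) \<le> B"
    unfolding bounded_iff ball_simps by metis
  obtain A where A: "\<And>\<epsilon>. \<epsilon> \<in> {0<..<\<eta>} \<Longrightarrow> norm (x i \<epsilon>) \<le> A"
    using bdd unfolding bounded_iff ball_simps by metis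
  have "norm (x (Suc i) \<epsilon>) \<le> A + B" if \<epsilon>: "\<epsilon> \<in> {0<..<\<eta>}" for \<epsilon>
  proof -
    have "norm (x (Suc i) \<epsilon>) \<le> norm ((1 - \<epsilon>) *\<^sub>R x i \<epsilon>) + norm (\<epsilon> *\<^sub>R T (Suc i) (x i \<epsilon>))"
      using x_Suc_convex[OF \<epsilon>, of i] Suc.prems norm_triangle_ineq by (metis Suc_le_eq)
    also have "\<dots> = (1 - \<epsilon>) * norm (x i \<epsilon>) + \<epsilon> * norm (T (Suc i) (x i \<epsilon>))"
      using \<epsilon> \<eta> by simp
    also have "\<dots> \<le> 1 * norm (x i \<epsilon>) + 1 * norm (T (Suc i) (x i \<epsilon>))"
      using \<epsilon> \<eta> by (intro add_mono mult_right_mono) auto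
    also have "\<dots> \<le> A + B" using A[OF \<epsilon>] B[OF \<epsilon>] by simp
    finally show ?thesis .
  qed
  then show ?case unfolding bounded_iff by blast
qed

lemma tuple_bounded: "tuple_bounded_on m {0<..<\<eta>} x"
proof -
  have "\<exists>B. \<forall>\<epsilon>\<in>{0<..<\<eta>}. norm (x i \<epsilon>) \<le> B" if "i \<le> m" for i
    using bounded_x[OF that] by (auto simp: bounded_iff)
  then obtain B where B: "\<And>i \<epsilon>. i \<le> m \<Longrightarrow> \<epsilon> \<in> {0<..<\<eta>} \<Longrightarrow> norm (x i \<epsilon>) \<le> B i" by metis
  have "L2_set (\<lambda>i. norm (x i \<epsilon>)) {1..m} \<le> (\<Sum>i\<in>{1..m}. B i)" if "\<epsilon> \<in> {0<..<\<eta>}" for \<epsilon>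
  proof -
    have "L2_set (\<lambda>i. norm (x i \<epsilon>)) {1..m} \<le> (\<Sum>i\<in>{1..m}. norm (x i \<epsilon>))"
      by (rule L2_set_le_sum) simp
    also have "\<dots> \<le> (\<Sum>i\<in>{1..m}. B i)" using B that by (intro sum_mono) auto
    finally show ?thesis .
  qed
  then show ?thesis unfolding tuple_bounded_on_def by blast
qed

lemma step_tendsto_0:
  assumes "i < m"
  shows "((\<lambda>\<epsilon>. x (Suc i) \<epsilon> - x i \<epsilon>) \<longlongrightarrow> 0) (at_right 0)"
proof -
  have "bounded (x i ` {0<..<\<eta>})" using assms bounded_x by simp
  moreover from this have "bounded (T (Suc i) ` x i ` {0<..<\<eta>})"
    using assms nonexp[of "Suc i"] x_in_D by (intro bounded_nonexpansive_image[of D]) auto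
  ultimately obtain A B where A: "\<And>\<epsilon>. \<epsilon> \<in> {0<..<\<eta>} \<Longrightarrow> norm (x i \<epsilon>) \<le> A"
    and B: "\<And>\<epsilon>. \<epsilon> \<in> {0<..<\<eta>} \<Longrightarrow> norm (T (Suc i) (x i \<epsilon>)) \<le> B"
    unfolding bounded_iff ball_simps by metis
  have "norm (x (Suc i) \<epsilon> - x i \<epsilon>) \<le> \<epsilon> * (B + A)" if \<epsilon>: "\<epsilon> \<in> {0<..<\<eta>}" for \<epsilon>
  proof -
    have "norm (T (Suc i) (x i \<epsilon>) - x i \<epsilon>) \<le> B + A"
      using norm_triangle_ineq4[of "T (Suc i) (x i \<epsilon>)" "x i \<epsilon>"] A[OF \<epsilon>] B[OF \<epsilon>] by linarith
    then show ?thesis using x_Suc[OF \<epsilon> assms] \<epsilon> by (simp add: mult_left_mono)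
  qed
  then have "\<forall>\<^sub>F \<epsilon> in at_right 0. norm (x (Suc i) \<epsilon> - x i \<epsilon>) \<le> \<epsilon> * (B + A)"
    by (rule eventually_mono[OF eventually_\<eta>])
  moreover have "((\<lambda>\<epsilon>. \<epsilon> * (B + A)) \<longlongrightarrow> 0) (at_right 0)"
    by (rule tendsto_mult_left_zero[OF tendsto_ident_at])
  ultimately show ?thesis by (rule Lim_null_comparison)
qed

lemma x_diff_z_tendsto_0:
  assumes "i \<le> m"
  shows "((\<lambda>\<epsilon>. x i \<epsilon> - z \<epsilon>) \<longlongrightarrow> 0) (at_right 0)"
  using assms
proof (induction i)
  case 0
  show ?case
    by (rule tendsto_eventually, rule eventually_mono[OF eventually_\<eta>]) (simp add: x_0)
next
  case (Suc i)
  then have "((\<lambda>\<epsilon>. (x (Suc i) \<epsilon> - x i \<epsilon>) + (x i \<epsilon> - z \<epsilon>)) \<longlongrightarrow> 0 + 0) (at_right 0)"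
    by (intro tendsto_add step_tendsto_0) auto
  then show ?case by simp
qed

text \<open>The steps of a closed cycle add up to \<open>0\<close>; dividing by \<open>\<epsilon>\<close>, so do the unscaled displacements.
  This exact cancellation is what brings in the average operator.\<close>

lemma sum_displacement_eq_0:
  assumes \<epsilon>: "\<epsilon> \<in> {0<..<\<eta>}"
  shows "(\<Sum>i<m. T (Suc i) (x i \<epsilon>) - x i \<epsilon>) = 0"
proof -
  have "\<epsilon> *\<^sub>R (\<Sum>i<m. T (Suc i) (x i \<epsilon>) - x i \<epsilon>) = (\<Sum>i<m. x (Suc i) \<epsilon> - x i \<epsilon>)"
    by (simp add: scaleR_sum_right x_Suc[OF \<epsilon>])
  also have "\<dots> = 0"
    using sum_lessThan_telescope[of "\<lambda>i. x i \<epsilon>" m] x_m[OF \<epsilon>] x_0[OF \<epsilon>] by simp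
  finally show ?thesis using \<epsilon> by simp
qed

text \<open>Since all points of the cycle approach \<open>z \<epsilon>\<close>, the vanishing sum of displacements
  may be evaluated at \<open>z \<epsilon>\<close> up to an error that tends to \<open>0\<close>.\<close>

lemma residual_tendsto_0:
  "((\<lambda>\<epsilon>. z \<epsilon> - avg_op m T (z \<epsilon>)) \<longlongrightarrow> 0) (at_right 0)"
proof -
  have "norm (z \<epsilon> - avg_op m T (z \<epsilon>)) \<le> (1 / real m) * (\<Sum>i<m. 2 * norm (x i \<epsilon> - z \<epsilon>))"
    if \<epsilon>: "\<epsilon> \<in> {0<..<\<eta>}" for \<epsilon>
  proof -
    have "(\<Sum>i\<in>{1..m}. T i (z \<epsilon>)) = (\<Sum>i<m. T (Suc i) (z \<epsilon>))"
      by (simp add: sum.atLeast1_atMost_eq)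
    moreover have "z \<epsilon> = (1 / real m) *\<^sub>R (\<Sum>i<m. z \<epsilon>)"
      using m_pos by (simp add: sum_constant_scaleR)
    ultimately have "z \<epsilon> - avg_op m T (z \<epsilon>)
        = (1 / real m) *\<^sub>R (\<Sum>i<m. z \<epsilon> - T (Suc i) (z \<epsilon>))"
      by (simp add: avg_op_def sum_subtractf scaleR_diff_right)
    also have "(\<Sum>i<m. z \<epsilon> - T (Suc i) (z \<epsilon>))
        = (\<Sum>i<m. (T (Suc i) (x i \<epsilon>) - T (Suc i) (z \<epsilon>)) - (x i \<epsilon> - z \<epsilon>))"
      using sum_displacement_eq_0[OF \<epsilon>] by (simp add: sum_subtractf)
    finally have eq: "z \<epsilon> - avg_op m T (z \<epsilon>) = (1 / real m) *\<^sub>R \<dots>" .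
    have "norm ((T (Suc i) (x i \<epsilon>) - T (Suc i) (z \<epsilon>)) - (x i \<epsilon> - z \<epsilon>))
        \<le> 2 * norm (x i \<epsilon> - z \<epsilon>)" if "i < m" for i
    proof -
      have "norm (T (Suc i) (x i \<epsilon>) - T (Suc i) (z \<epsilon>)) \<le> norm (x i \<epsilon> - z \<epsilon>)"
        using lipschitz_on_normD[OF nonexp[unfolded nonexpansive_on_def], of "Suc i" "x i \<epsilon>" "z \<epsilon>"]
          that x_in_D[OF \<epsilon>, of i] z_in_D[OF \<epsilon>] by simp
      then show ?thesis
        using norm_triangle_ineq4[of "T (Suc i) (x i \<epsilon>) - T (Suc i) (z \<epsilon>)" "x i \<epsilon> - z \<epsilon>"] by linarith
    qed
    then show ?thesis
      unfolding eq norm_scaleR by (auto intro!: divide_right_mono sum_norm_le)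
  qed
  then have "\<forall>\<^sub>F \<epsilon> in at_right 0.
      norm (z \<epsilon> - avg_op m T (z \<epsilon>)) \<le> (1 / real m) * (\<Sum>i<m. 2 * norm (x i \<epsilon> - z \<epsilon>))"
    by (rule eventually_mono[OF eventually_\<eta>])
  moreover have "((\<lambda>\<epsilon>. (1 / real m) * (\<Sum>i<m. 2 * norm (x i \<epsilon> - z \<epsilon>))) \<longlongrightarrow> 0) (at_right 0)"
    by (intro tendsto_mult_right_zero tendsto_null_sum tendsto_norm_zero x_diff_z_tendsto_0) auto
  ultimately show ?thesis by (rule Lim_null_comparison)
qed

lemma filterlim_at_right_curve:
  assumes "\<And>n. e n \<in> {0<..<\<eta>}" "e \<longlonglongrightarrow> 0"
  shows "filterlim e (at_right 0) sequentially"
  using assms by (intro tendsto_imp_filterlim_at_right) auto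

lemma weak_cluster_point_in_Fix:
  assumes e: "\<And>n. e n \<in> {0<..<\<eta>}" "e \<longlonglongrightarrow> 0"
    and weak: "weakly_tendsto (\<lambda>n. z (e n)) p sequentially"
  shows "p \<in> Fix_on D (avg_op m T)"
proof (rule demiclosed_nonexpansive[OF closed_D convex_D _ _ _ weak])
  show "nonexpansive_on D (avg_op m T)" by (rule nonexpansive_on_avg_op[OF nonexp])
  show "z (e n) \<in> D" for n using z_in_D e(1) .
  show "bounded (range (\<lambda>n. z (e n)))"
    by (rule bounded_subset[OF bounded_z]) (use e(1) in blast)
  show "(\<lambda>n. z (e n) - avg_op m T (z (e n))) \<longlonglongrightarrow> 0"
    using filterlim_compose[OF residual_tendsto_0 filterlim_at_right_curve[OF e]] .
qed

lemma weak_cluster_point_exists: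
  assumes e: "\<And>n. e n \<in> {0<..<\<eta>}" "e \<longlonglongrightarrow> 0"
  obtains r p where "strict_mono r" "p \<in> Fix_on D (avg_op m T)"
    "weakly_tendsto (\<lambda>n. z (e (r n))) p sequentially"
proof -
  have "bounded (range (\<lambda>n. z (e n)))"
    by (rule bounded_subset[OF bounded_z]) (use e(1) in blast)
  then obtain r p where rp: "strict_mono r" "weakly_tendsto ((\<lambda>n. z (e n)) \<circ> r) p sequentially"
    by (rule bounded_imp_weakly_convergent_subsequence)
  then have weak: "weakly_tendsto (\<lambda>n. z (e (r n))) p sequentially" by (simp add: o_def)
  have "(\<lambda>n. e (r n)) \<longlonglongrightarrow> 0"
    using LIMSEQ_subseq_LIMSEQ[OF e(2) rp(1)] by (simp add: o_def)
  from weak_cluster_point_in_Fix[OF e(1) this weak] that rp(1) weak show ?thesis by blast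
qed

lemma curve_sequence:
  "\<eta> / real (Suc (Suc n)) \<in> {0<..<\<eta>}" "(\<lambda>n. \<eta> / real (Suc (Suc n))) \<longlonglongrightarrow> 0"
proof -
  show "\<eta> / real (Suc (Suc n)) \<in> {0<..<\<eta>}"
    using \<eta> by (simp add: divide_less_eq)
  show "(\<lambda>n. \<eta> / real (Suc (Suc n))) \<longlonglongrightarrow> 0"
    using LIMSEQ_Suc[OF tendsto_mult_right_zero[OF LIMSEQ_Suc[OF lim_1_over_n], of \<eta>]] by simp
qed

lemma Fix_avg_op_nonempty: "Fix_on D (avg_op m T) \<noteq> {}"
  by (rule weak_cluster_point_exists[OF curve_sequence]) blast

lemma tuple_weak_cluster_point:
  assumes "tuple_weak_seq_cluster_point m \<eta> x w"
  shows "\<exists>p\<in>Fix_on D (avg_op m T). \<forall>i\<in>{1..m}. w i = p"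
proof -
  obtain e where e: "\<And>n. e n \<in> {0<..<\<eta>}" "e \<longlonglongrightarrow> 0"
    and tup: "tuple_weakly_tendsto m (\<lambda>i n. x i (e n)) w sequentially"
    using assms unfolding tuple_weak_seq_cluster_point_def by blast
  have weak_x: "weakly_tendsto (\<lambda>n. x i (e n)) (w i) sequentially" if i: "i \<in> {1..m}" for i
    unfolding weakly_tendsto_def
  proof
    fix u
    \<comment> \<open>Test against the tuple with \<open>u\<close> in position \<open>i\<close> and \<open>0\<close> elsewhere.\<close>
    have pick: "(\<Sum>j\<in>{1..m}. a j \<bullet> (if j = i then u else 0)) = a i \<bullet> u" for a :: "nat \<Rightarrow> 'a"
      using i by (simp add: if_distrib[of "(\<bullet>) _"] cong: if_cong)
    show "(\<lambda>n. x i (e n) \<bullet> u) \<longlonglongrightarrow> w i \<bullet> u"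
      using tup[unfolded tuple_weakly_tendsto_def, rule_format, of "\<lambda>j. if j = i then u else 0"]
      unfolding pick .
  qed
  have weak_z: "weakly_tendsto (\<lambda>n. z (e n)) (w i) sequentially" if i: "i \<in> {1..m}" for i
  proof (rule weakly_tendsto_add_strong[OF weak_x[OF i]])
    have "(\<lambda>n. x i (e n) - z (e n)) \<longlonglongrightarrow> 0"
      using filterlim_compose[OF x_diff_z_tendsto_0 filterlim_at_right_curve[OF e]] i by auto
    from tendsto_minus[OF this] show "(\<lambda>n. z (e n) - x i (e n)) \<longlonglongrightarrow> 0" by simp
  qed
  have 1: "1 \<in> {1..m}" using m_pos by simp
  have "w i = w 1" if "i \<in> {1..m}" for i
    using weakly_tendsto_unique[OF weak_z[OF that] weak_z[OF 1]] by simp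
  with weak_cluster_point_in_Fix[OF e weak_z[OF 1]] show ?thesis by blast
qed

text \<open>Convergence of \<open>z \<epsilon> \<bullet> (p - q)\<close> forces \<open>p \<bullet> (p - q) = q \<bullet> (p - q)\<close> for two cluster points
  \<open>p\<close> and \<open>q\<close>. So there is only one, and boundedness makes the whole curve converge
  to it.\<close>

lemma weak_convergence:
  assumes conv: "\<And>p q. p \<in> Fix_on D (avg_op m T) \<Longrightarrow> q \<in> Fix_on D (avg_op m T) \<Longrightarrow>
      \<exists>l. ((\<lambda>\<epsilon>. z \<epsilon> \<bullet> (p - q)) \<longlongrightarrow> l) (at_right 0)"
  obtains xbar where "xbar \<in> Fix_on D (avg_op m T)"
    "weakly_tendsto z xbar (at_right 0)"
proof -
  have unique: "p = q"
    if e: "\<And>n. e n \<in> {0<..<\<eta>}" "e \<longlonglongrightarrow> 0" "weakly_tendsto (\<lambda>n. z (e n)) p sequentially"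
    and e': "\<And>n. e' n \<in> {0<..<\<eta>}" "e' \<longlonglongrightarrow> 0" "weakly_tendsto (\<lambda>n. z (e' n)) q sequentially"
    for e e' p q
  proof -
    obtain l where l: "((\<lambda>\<epsilon>. z \<epsilon> \<bullet> (p - q)) \<longlongrightarrow> l) (at_right 0)"
      using conv weak_cluster_point_in_Fix[OF e] weak_cluster_point_in_Fix[OF e'] by blast
    have "p \<bullet> (p - q) = l"
      by (rule LIMSEQ_unique[OF weakly_tendstoD[OF e(3)]
            filterlim_compose[OF l filterlim_at_right_curve[OF e(1,2)]]])
    moreover have "q \<bullet> (p - q) = l"
      by (rule LIMSEQ_unique[OF weakly_tendstoD[OF e'(3)]
            filterlim_compose[OF l filterlim_at_right_curve[OF e'(1,2)]]])
    ultimately have "(p - q) \<bullet> (p - q) = 0" by (simp add: inner_diff_left)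
    then show ?thesis by simp
  qed
  define e where "e = (\<lambda>n. \<eta> / real (Suc (Suc n)))"
  have e: "e n \<in> {0<..<\<eta>}" "e \<longlonglongrightarrow> 0" for n
    unfolding e_def by (rule curve_sequence)+
  obtain r xbar where xbar: "strict_mono r" "xbar \<in> Fix_on D (avg_op m T)"
    "weakly_tendsto (\<lambda>n. z (e (r n))) xbar sequentially"
    using weak_cluster_point_exists[OF e] .
  have er: "(\<lambda>n. e (r n)) \<longlonglongrightarrow> 0"
    using LIMSEQ_subseq_LIMSEQ[OF e(2) xbar(1)] by (simp add: o_def)
  have "((\<lambda>\<epsilon>. z \<epsilon> \<bullet> u) \<longlongrightarrow> xbar \<bullet> u) (at_right 0)" for u
  proof (rule tendsto_at_right_sequentially[OF \<eta>(1)])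
    fix f assume "\<And>n. 0 < f n" "\<And>n. f n < \<eta>" and f0: "f \<longlonglongrightarrow> 0"
    then have f: "f n \<in> {0<..<\<eta>}" for n by simp
    show "(\<lambda>n. z (f n) \<bullet> u) \<longlonglongrightarrow> xbar \<bullet> u"
      \<comment> \<open>A subsequence that stayed away would have a weak cluster point, necessarily \<open>xbar\<close>.\<close>
    proof (rule tendstoI, rule ccontr)
      fix d :: real
      assume "d > 0" and "\<not> (\<forall>\<^sub>F n in sequentially. dist (z (f n) \<bullet> u) (xbar \<bullet> u) < d)"
      then obtain k :: "nat \<Rightarrow> nat" where k: "strict_mono k"
        and far: "\<And>n. \<not> dist (z (f (k n)) \<bullet> u) (xbar \<bullet> u) < d"
        using not_eventually_sequentiallyD by blast
      have fk: "(\<lambda>n. f (k n)) \<longlonglongrightarrow> 0"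
        using LIMSEQ_subseq_LIMSEQ[OF f0 k] by (simp add: o_def)
      obtain j p where j: "strict_mono j" "p \<in> Fix_on D (avg_op m T)"
        "weakly_tendsto (\<lambda>n. z (f (k (j n)))) p sequentially"
        by (rule weak_cluster_point_exists[of "\<lambda>n. f (k n)", OF f fk])
      have "(\<lambda>n. f (k (j n))) \<longlonglongrightarrow> 0"
        using LIMSEQ_subseq_LIMSEQ[OF fk j(1)] by (simp add: o_def)
      then have "p = xbar"
        by (rule unique[of "\<lambda>n. f (k (j n))" p "\<lambda>n. e (r n)" xbar, OF f _ j(3) e(1) er xbar(3)])
      then have "\<forall>\<^sub>F n in sequentially. dist (z (f (k (j n))) \<bullet> u) (xbar \<bullet> u) < d"
        using tendstoD[OF weakly_tendstoD[OF j(3)] \<open>d > 0\<close>] by simp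
      then show False using far by (auto simp: eventually_sequentially)
    qed
  qed
  with xbar(2) show ?thesis using that unfolding weakly_tendsto_def by blast
qed

text \<open>The squared distances of \<open>z \<epsilon>\<close> to \<open>q\<close> and to \<open>p\<close> differ by \<open>2 * (z \<epsilon> \<bullet> (p - q))\<close> plus a
  constant, so convergence of both distances yields convergence of the scalar product.\<close>

lemma distances_converge_imp_inner_converge:
  assumes "((\<lambda>\<epsilon>. norm (z \<epsilon> - p)) \<longlongrightarrow> a) (at_right 0)" "((\<lambda>\<epsilon>. norm (z \<epsilon> - q)) \<longlongrightarrow> b) (at_right 0)"
  shows "\<exists>l. ((\<lambda>\<epsilon>. z \<epsilon> \<bullet> (p - q)) \<longlongrightarrow> l) (at_right 0)"
proof -
  have eq: "z \<epsilon> \<bullet> (p - q)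
      = ((norm (z \<epsilon> - q))\<^sup>2 - (norm (z \<epsilon> - p))\<^sup>2 + (norm p)\<^sup>2 - (norm q)\<^sup>2) / 2" for \<epsilon>
    by (simp add: power2_norm_eq_inner inner_diff_left inner_diff_right inner_commute)
  have "((\<lambda>\<epsilon>. ((norm (z \<epsilon> - q))\<^sup>2 - (norm (z \<epsilon> - p))\<^sup>2 + (norm p)\<^sup>2 - (norm q)\<^sup>2) / 2)
      \<longlongrightarrow> (b\<^sup>2 - a\<^sup>2 + (norm p)\<^sup>2 - (norm q)\<^sup>2) / 2) (at_right 0)"
    using assms by (intro tendsto_intros) auto
  then show ?thesis unfolding eq[symmetric] by (rule exI)
qed

lemma strong_convergence:
  assumes xbar: "xbar \<in> Fix_on D (avg_op m T)" "weakly_tendsto z xbar (at_right 0)"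
    and demi: "Id_minus_demiregular_on_Fix D (avg_op m T)"
  shows "(z \<longlongrightarrow> xbar) (at_right 0)"
proof (rule tendsto_at_right_sequentially[OF \<eta>(1)])
  fix e assume "\<And>n. 0 < e n" "\<And>n. e n < \<eta>" and e0: "e \<longlonglongrightarrow> 0"
  then have e: "e n \<in> {0<..<\<eta>}" for n by simp
  note lim = filterlim_at_right_curve[OF e e0]
  have "weakly_tendsto (\<lambda>n. z (e n)) xbar sequentially"
    unfolding weakly_tendsto_def
    using filterlim_compose[OF weakly_tendstoD[OF xbar(2)] lim] by simp
  moreover have "(\<lambda>n. z (e n) - avg_op m T (z (e n))) \<longlonglongrightarrow> 0"
    using filterlim_compose[OF residual_tendsto_0 lim] .
  ultimately show "(\<lambda>n. z (e n)) \<longlonglongrightarrow> xbar"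
    using demi[unfolded Id_minus_demiregular_on_Fix_def, rule_format, of "\<lambda>n. z (e n)" xbar]
      z_in_D[OF e] xbar(1) by simp
qed

lemma cycle_convergence:
  assumes "(\<forall>p\<in>Fix_on D (avg_op m T). \<forall>q\<in>Fix_on D (avg_op m T).
        \<exists>l. ((\<lambda>\<epsilon>. x m \<epsilon> \<bullet> (p - q)) \<longlongrightarrow> l) (at_right 0))
      \<or> (\<forall>p\<in>Fix_on D (avg_op m T). \<exists>l. ((\<lambda>\<epsilon>. norm (x m \<epsilon> - p)) \<longlongrightarrow> l) (at_right 0))
      \<or> is_singleton (Fix_on D (avg_op m T))"
  shows "\<exists>xbar\<in>Fix_on D (avg_op m T).
      (\<forall>i\<in>{1..m}. weakly_tendsto (x i) xbar (at_right 0)) \<and>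
      (Id_minus_demiregular_on_Fix D (avg_op m T) \<longrightarrow>
        (\<forall>i\<in>{1..m}. (x i \<longlongrightarrow> xbar) (at_right 0)))"
proof -
  have xm: "\<forall>\<^sub>F \<epsilon> in at_right 0. x m \<epsilon> = z \<epsilon>"
    by (rule eventually_mono[OF eventually_\<eta> x_m])
  have inner_z: "((\<lambda>\<epsilon>. x m \<epsilon> \<bullet> u) \<longlongrightarrow> l) (at_right 0) \<longleftrightarrow> ((\<lambda>\<epsilon>. z \<epsilon> \<bullet> u) \<longlongrightarrow> l) (at_right 0)" for u l
    by (intro tendsto_cong eventually_mono[OF xm]) simp
  have norm_z: "((\<lambda>\<epsilon>. norm (x m \<epsilon> - u)) \<longlongrightarrow> l) (at_right 0)
      \<longleftrightarrow> ((\<lambda>\<epsilon>. norm (z \<epsilon> - u)) \<longlongrightarrow> l) (at_right 0)" for u l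
    by (intro tendsto_cong eventually_mono[OF xm]) simp
  have conv: "\<exists>l. ((\<lambda>\<epsilon>. z \<epsilon> \<bullet> (p - q)) \<longlongrightarrow> l) (at_right 0)"
    if pq: "p \<in> Fix_on D (avg_op m T)" "q \<in> Fix_on D (avg_op m T)" for p q
    using assms unfolding inner_z norm_z
  proof (elim disjE)
    assume "is_singleton (Fix_on D (avg_op m T))"
    then have "p = q" using pq by (auto simp: is_singleton_def)
    then show ?thesis by auto
  qed (use pq distances_converge_imp_inner_converge in blast)+
  obtain xbar where xbar: "xbar \<in> Fix_on D (avg_op m T)" "weakly_tendsto z xbar (at_right 0)"
    by (rule weak_convergence[OF conv])
  have "weakly_tendsto (x i) xbar (at_right 0)" if "i \<in> {1..m}" for i
    using weakly_tendsto_add_strong[OF xbar(2) x_diff_z_tendsto_0] that by simp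
  moreover have "(x i \<longlongrightarrow> xbar) (at_right 0)"
    if "Id_minus_demiregular_on_Fix D (avg_op m T)" "i \<in> {1..m}" for i
    using tendsto_add[OF x_diff_z_tendsto_0 strong_convergence[OF xbar that(1)], of i] that(2) by simp
  ultimately show ?thesis using xbar(1) by blast
qed

end

section \<open>Behaviour of the cycles as the relaxation parameter vanishes\<close>

theorem theorem2p8:
  fixes D :: "'a::{real_inner, complete_space} set"
    and m :: nat
    and T :: "nat \<Rightarrow> 'a \<Rightarrow> 'a"
  assumes "D \<noteq> {}" and "closed D" and "convex D"
    and "m \<ge> 2"
    and "\<forall>i\<in>{1..m}. T i \<in> D \<rightarrow> D"
    and "\<forall>i\<in>{1..m}. nonexpansive_on D (T i)"
  shows
    "((\<exists>\<eta>\<in>{0<..1}. \<exists>\<beta>>0. \<forall>\<epsilon>\<in>{0<..<\<eta>}. \<exists>z\<in>Fix_on D (relaxed_comp T \<epsilon> m). norm z \<le> \<beta>)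
        \<longrightarrow> Fix_on D (avg_op m T) \<noteq> {})
     \<and>
     (\<forall>(\<eta>::real) (\<beta>::real) (z :: real \<Rightarrow> 'a) (x :: nat \<Rightarrow> real \<Rightarrow> 'a).
        \<eta> \<in> {0<..1} \<longrightarrow> \<beta> > 0 \<longrightarrow>
        (\<forall>\<epsilon>\<in>{0<..<\<eta>}. z \<epsilon> \<in> Fix_on D (relaxed_comp T \<epsilon> m) \<and> norm (z \<epsilon>) \<le> \<beta>) \<longrightarrow>
        (\<forall>\<epsilon>\<in>{0<..<\<eta>}. x 0 \<epsilon> = z \<epsilon> \<and>
           (\<forall>i\<in>{1..m}. x i \<epsilon> = x (i - 1) \<epsilon> + \<epsilon> *\<^sub>R (T i (x (i - 1) \<epsilon>) - x (i - 1) \<epsilon>))) \<longrightarrow>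
        (\<forall>\<epsilon>\<in>{0<..<\<eta>}. x m \<epsilon> = z \<epsilon>) \<and>
        tuple_bounded_on m {0<..<\<eta>} x \<and>
        (\<forall>w. tuple_weak_seq_cluster_point m \<eta> x w \<longrightarrow>
           (\<exists>p\<in>Fix_on D (avg_op m T). \<forall>i\<in>{1..m}. w i = p)) \<and>
        (\<forall>i\<in>{1..m}. ((\<lambda>\<epsilon>. norm (x i \<epsilon> - x (i - 1) \<epsilon>)) \<longlongrightarrow> 0) (at_right 0)) \<and>
        ((\<forall>p\<in>Fix_on D (avg_op m T). \<forall>q\<in>Fix_on D (avg_op m T).
            \<exists>l. ((\<lambda>\<epsilon>. x m \<epsilon> \<bullet> (p - q)) \<longlongrightarrow> l) (at_right 0))
         \<or> (\<forall>p\<in>Fix_on D (avg_op m T). \<exists>l. ((\<lambda>\<epsilon>. norm (x m \<epsilon> - p)) \<longlongrightarrow> l) (at_right 0))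
         \<or> is_singleton (Fix_on D (avg_op m T))
         \<longrightarrow>
         (\<exists>xbar\<in>Fix_on D (avg_op m T).
            (\<forall>i\<in>{1..m}. weakly_tendsto (x i) xbar (at_right 0)) \<and>
            (Id_minus_demiregular_on_Fix D (avg_op m T) \<longrightarrow>
               (\<forall>i\<in>{1..m}. ((x i) \<longlongrightarrow> xbar) (at_right 0))))))"
proof (intro conjI[OF impI allI] allI impI, goal_cases)
  case 1
  then obtain \<eta> \<beta> where \<eta>: "\<eta> \<in> {0<..1}"
    and "\<forall>\<epsilon>\<in>{0<..<\<eta>}. \<exists>z\<in>Fix_on D (relaxed_comp T \<epsilon> m). norm z \<le> \<beta>" by blast
  then obtain z where z: "\<And>\<epsilon>. \<epsilon> \<in> {0<..<\<eta>} \<Longrightarrow>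
      z \<epsilon> \<in> Fix_on D (relaxed_comp T \<epsilon> m) \<and> norm (z \<epsilon>) \<le> \<beta>" by metis
  have step: "relaxed_comp T \<epsilon> i (z \<epsilon>) = relaxed_comp T \<epsilon> (i - 1) (z \<epsilon>)
      + \<epsilon> *\<^sub>R (T i (relaxed_comp T \<epsilon> (i - 1) (z \<epsilon>)) - relaxed_comp T \<epsilon> (i - 1) (z \<epsilon>))"
    if "i \<in> {1..m}" for i \<epsilon>
    using that by (cases i) (auto simp: relaxed_def)
  interpret relaxed_cycle_curve D m T \<eta> \<beta> z "\<lambda>i \<epsilon>. relaxed_comp T \<epsilon> i (z \<epsilon>)"
    using assms \<eta> z step by unfold_locales auto
  show ?case by (rule Fix_avg_op_nonempty)
next
  case (2 \<eta> \<beta> z x)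
  then interpret relaxed_cycle_curve D m T \<eta> \<beta> z x
    using assms by unfold_locales auto
  show ?case
  proof (intro conjI allI impI ballI)
    fix i assume "i \<in> {1..m}"
    then have "i - 1 < m" "Suc (i - 1) = i" by auto
    then show "((\<lambda>\<epsilon>. norm (x i \<epsilon> - x (i - 1) \<epsilon>)) \<longlongrightarrow> 0) (at_right 0)"
      using tendsto_norm_zero[OF step_tendsto_0[of "i - 1"]] by simp
  qed (fact x_m tuple_bounded | erule tuple_weak_cluster_point | rule cycle_convergence)+
qed

end
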